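(* Let $m,n\geq2$, $d\geq0$, and $j\geq1$. Then the number of Fibonacci polyominoes $P\in\mathcal F_{m,n}$ with $\operatorname{des}(P)=d$ and $\operatorname{lmin}(P)=j$ equals \[ R(m,d+1,j)\binom{n-2}{m-1}+R(m-1,d,j-1)\binom{n-2}{m-2}. \]
   Context: A Fibonacci polyomino is a (nonempty) polyomino, considered up to translation, that is column-convex (each column is a contiguous segment of unit cells) and such that, reading columns from left to right, the bottom cell of each column lies exactly one unit above the bottom cell of the preceding column. Equivalently, it is given by a sequence of column heights $(h_1,\dots,h_m)$, $m\ge 1$, with $h_i\ge 2$ for $1\le i\le m-1$ and $h_m\ge 1$; column $i$ consists of the cells in column position $i$ and rows $i,i+1,\dots,i+h_i-1$. The horizontal (resp. vertical) semiperimeter is half the number of horizontal (resp. vertical) unit edges on the boundary (edges belonging to exactly one cell). $\mathcal F_{m,n}$ is the set of Fibonacci polyominoes with horizontal semiperimeter $m$ (equivalently $m$ columns) and vertical semiperimeter $n$. For $P$ with column heights $(h_1,\ldots,h_m)$: $\operatorname{des}(P)=|\{i:1\le i<m,\ h_i>h_{i+1}\}|$; $\operatorname{lmin}(P)$ is the number of left-to-right minima, i.e. of columns $i$ such that $i=1$ or $h_i<\min\{h_1,\ldots,h_{i-1}\}$. For $\ell\ge1$, $R(\ell,k,j)$ is the number of Dyck paths of semilength $\ell$ (paths from $(0,0)$ to $(2\ell,0)$ with steps $U=(1,1)$, $D=(1,-1)$ never going below the horizontal axis) with exactly $k$ peaks (consecutive steps $UD$) and exactly $j$ returns (down steps ending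 on the axis). It is known that $R(\ell,k,j)=\frac{j}{\ell}\binom{\ell}{k}\binom{\ell-j-1}{k-j}$ for $1\le j\le k\le\ell$, $j<\ell$; $R(\ell,\ell,\ell)=1$; and $R(\ell,k,j)=0$ otherwise. Binomial coefficients $\binom ab$ with $a\ge0$ vanish if $b<0$ or $b>a$. *)

theory Defs
  imports Complex_Main
begin

text \<open>The pair (x, y) stands for the unit cell with lower left corner (x, y).\<close>

type_synonym cell = "int \<times> int"

definition adjacent :: "cell \<Rightarrow> cell \<Rightarrow> bool" where
  "adjacent c c' \<longleftrightarrow> \<bar>fst c - fst c'\<bar> + \<bar>snd c - snd c'\<bar> = 1"

definition polyomino :: "cell set \<Rightarrow> bool" where
  "polyomino P \<longleftrightarrow> finite P \<and> P \<noteq> {} \<and>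
     (\<forall>c\<in>P. \<forall>c'\<in>P. (c, c') \<in> {(a, b). a \<in> P \<and> b \<in> P \<and> adjacent a b}\<^sup>*)"

definition translate :: "int \<times> int \<Rightarrow> cell set \<Rightarrow> cell set" where
  "translate t P = (\<lambda>(x, y). (x + fst t, y + snd t)) ` P"

definition translation_rel :: "(cell set \<times> cell set) set" where
  "translation_rel = {(P, Q). \<exists>t. Q = translate t P}"

definition column :: "cell set \<Rightarrow> int \<Rightarrow> int set" where
  "column P x = {y. (x, y) \<in> P}"

definition column_convex :: "cell set \<Rightarrow> bool" where
  "column_convex P \<longleftrightarrow> (\<forall>x. \<exists>a b. column P x = {a..b})"

text \<open>The nonempty columns of a polyomino occupy consecutive positions, so the column
  preceding the one at position x + 1 is the one at position x.\<close>

definition fibonacci_polyomino :: "cell set \<Rightarrow> bool" where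
  "fibonacci_polyomino P \<longleftrightarrow> polyomino P \<and> column_convex P \<and>
     (\<forall>x. column P x \<noteq> {} \<and> column P (x + 1) \<noteq> {} \<longrightarrow>
        Min (column P (x + 1)) = Min (column P x) + 1)"

text \<open>A horizontal unit edge is named by its left endpoint, a vertical one by its lower
  endpoint.\<close>

definition horizontal_edges :: "cell \<Rightarrow> (int \<times> int) set" where
  "horizontal_edges c = {(fst c, snd c), (fst c, snd c + 1)}"

definition vertical_edges :: "cell \<Rightarrow> (int \<times> int) set" where
  "vertical_edges c = {(fst c, snd c), (fst c + 1, snd c)}"

definition horizontal_semiperimeter :: "cell set \<Rightarrow> real" where
  "horizontal_semiperimeter P = real (card {e. \<exists>!c. c \<in> P \<and> e \<in> horizontal_edges c}) / 2"

definition vertical_semiperimeter :: "cell set \<Rightarrow> real" where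
  "vertical_semiperimeter P = real (card {e. \<exists>!c. c \<in> P \<and> e \<in> vertical_edges c}) / 2"

text \<open>Concrete Fibonacci polyominoes, before identifying translates.\<close>

definition fibonacci_polyominoes :: "nat \<Rightarrow> nat \<Rightarrow> cell set set" where
  "fibonacci_polyominoes m n = {P. fibonacci_polyomino P \<and>
     horizontal_semiperimeter P = real m \<and> vertical_semiperimeter P = real n}"

definition column_heights :: "cell set \<Rightarrow> nat list" where
  "column_heights P = map (\<lambda>x. card (column P x)) (sorted_list_of_set (fst ` P))"

definition des :: "cell set \<Rightarrow> nat" where
  "des P = (let h = column_heights P in card {i. Suc i < length h \<and> h ! i > h ! Suc i})"

definition lmin :: "cell set \<Rightarrow> nat" where
  "lmin P = (let h = column_heights P in
     card {i. i < length h \<and> (i = 0 \<or> h ! i < Min (set (take i h)))})"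

datatype step = Up | Down

definition level :: "step list \<Rightarrow> nat \<Rightarrow> int" where
  "level w i = (\<Sum>s\<leftarrow>take i w. case s of Up \<Rightarrow> 1 | Down \<Rightarrow> - 1)"

definition dyck_path :: "nat \<Rightarrow> step list \<Rightarrow> bool" where
  "dyck_path l w \<longleftrightarrow> length w = 2 * l \<and> level w (2 * l) = 0 \<and> (\<forall>i\<le>2 * l. level w i \<ge> 0)"

definition peaks :: "step list \<Rightarrow> nat" where
  "peaks w = card {i. Suc i < length w \<and> w ! i = Up \<and> w ! Suc i = Down}"

definition returns :: "step list \<Rightarrow> nat" where
  "returns w = card {i. i < length w \<and> w ! i = Down \<and> level w (Suc i) = 0}"

definition R :: "nat \<Rightarrow> nat \<Rightarrow> nat \<Rightarrow> nat" where
  "R l k j = card {w. dyck_path l w \<and> peaks w = k \<and> returns w = j}"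

lemma equiv_translation_rel: "equiv UNIV translation_rel"
proof (rule equivI)
  show "translation_rel \<subseteq> UNIV \<times> UNIV" by simp
  show "refl translation_rel"
  proof (rule refl_onI)
    fix P :: "cell set"
    have "P = translate (0, 0) P" by (simp add: translate_def)
    then show "(P, P) \<in> translation_rel" unfolding translation_rel_def by blast
  qed
  show "sym translation_rel"
  proof (rule symI)
    fix P Q assume "(P, Q) \<in> translation_rel"
    then obtain t where "Q = translate t P" by (auto simp: translation_rel_def)
    then have "P = translate (- fst t, - snd t) Q"
      by (simp add: translate_def image_image split_def)
    then show "(Q, P) \<in> translation_rel" unfolding translation_rel_def by blast
  qed
  show "trans translation_rel"
  proof (rule transI)
    fix P Q S assume "(P, Q) \<in> translation_rel" "(Q, S) \<in> translation_rel"
    then obtain s t where "Q = translate s P" "S = translate t Q"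
      by (auto simp: translation_rel_def)
    then have "S = translate (fst s + fst t, snd s + snd t) P"
      by (simp add: translate_def image_image split_def add.assoc)
    then show "(P, S) \<in> translation_rel" unfolding translation_rel_def by blast
  qed
qed

end

theory Submission
  imports Defs "HOL-Library.Tree"
begin

text \<open>A Fibonacci polyomino is determined up to translation by its column heights
  \<open>h\<^sub>1, \<dots>, h\<^sub>m\<close>, and its vertical semiperimeter is
  \<open>h\<^sub>1 + \<Sum>i. max 0 (h\<^sub>i\<^sub>+\<^sub>1 - h\<^sub>i + 1)\<close>. If the last height is 1, removing it lowers the
  numbers of descents and of left-to-right minima by one and keeps the semiperimeter; so it suffices
  to count sequences with all heights at least 2, that is, after subtracting 2, arbitrary sequences
  of natural numbers. Splitting such a sequence recursively at its leftmost minimum, and recording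
  the minimum relative to the one of the enclosing block, gives a binary tree with \<open>m\<close> nodes
  labelled by natural numbers. The semiperimeter becomes the sum of the labels plus \<open>m - 1\<close>, which
  accounts for the binomial coefficient, and under the usual bijection of binary trees with Dyck
  paths descents and left-to-right minima become peaks (minus one) and returns.\<close>

section \<open>Statistics of lists\<close>

lemma card_less_add:
  fixes m n :: nat
  shows "card {i. i < m + n \<and> P i} = card {i. i < m \<and> P i} + card {i. i < n \<and> P (m + i)}"
proof -
  have "{i. i < m + n \<and> P i} = {i. i < m \<and> P i} \<union> (+) m ` {i. i < n \<and> P (m + i)}"
    by (auto simp: image_iff) (metis add_less_cancel_left le_add_diff_inverse not_less)
  moreover have "{i. i < m \<and> P i} \<inter> (+) m ` {i. i < n \<and> P (m + i)} = {}"
    by auto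
  ultimately show ?thesis
    by (simp add: card_Un_disjoint card_image)
qed

definition count_consecutive :: "('a \<Rightarrow> 'a \<Rightarrow> bool) \<Rightarrow> 'a list \<Rightarrow> nat" where
  "count_consecutive Q xs = card {i. Suc i < length xs \<and> Q (xs ! i) (xs ! Suc i)}"

lemma count_consecutive_Nil [simp]: "count_consecutive Q [] = 0"
  by (simp add: count_consecutive_def)

lemma count_consecutive_Cons:
  "count_consecutive Q (x # xs) = of_bool (xs \<noteq> [] \<and> Q x (hd xs)) + count_consecutive Q xs"
proof (cases xs)
  case (Cons y ys)
  then show ?thesis
    using card_less_add[of 1 "length ys" "\<lambda>i. Q ((x # xs) ! i) (xs ! i)"]
    by (simp add: count_consecutive_def Collect_conv_if)
qed (simp add: count_consecutive_def)

lemma count_consecutive_append: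
  "count_consecutive Q (xs @ ys) = count_consecutive Q xs
    + of_bool (xs \<noteq> [] \<and> ys \<noteq> [] \<and> Q (last xs) (hd ys)) + count_consecutive Q ys"
  by (induction xs) (auto simp: count_consecutive_Cons)

lemma count_consecutive_map:
  "count_consecutive Q (map f xs) = count_consecutive (\<lambda>x y. Q (f x) (f y)) xs"
  by (auto simp: count_consecutive_def intro!: arg_cong[where f = card])

abbreviation descents :: "'a::linorder list \<Rightarrow> nat" where
  "descents \<equiv> count_consecutive (>)"

definition left_to_right_minima :: "'a::linorder list \<Rightarrow> nat" where
  "left_to_right_minima xs = card {i. i < length xs \<and> (i = 0 \<or> xs ! i < Min (set (take i xs)))}"

lemma left_to_right_minima_Nil [simp]: "left_to_right_minima [] = 0"
  by (simp add: left_to_right_minima_def)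

lemma left_to_right_minima_snoc:
  "left_to_right_minima (xs @ [x]) = left_to_right_minima xs + of_bool (\<forall>y \<in> set xs. x < y)"
proof -
  let ?P = "\<lambda>i. i = 0 \<or> (xs @ [x]) ! i < Min (set (take i (xs @ [x])))"
  have "left_to_right_minima (xs @ [x])
      = card {i. i < length xs \<and> ?P i} + card {i. i < 1 \<and> ?P (length xs + i)}"
    using card_less_add[of "length xs" 1 ?P] by (simp add: left_to_right_minima_def)
  also have "{i. i < length xs \<and> ?P i} =
      {i. i < length xs \<and> (i = 0 \<or> xs ! i < Min (set (take i xs)))}"
    by (auto simp: nth_append)
  also have "{i. i < 1 \<and> ?P (length xs + i)} = (if \<forall>y \<in> set xs. x < y then {0} else {})"
    by (cases "xs = []") auto
  finally show ?thesis
    by (simp add: left_to_right_minima_def)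
qed

lemma left_to_right_minima_append_Cons:
  assumes "\<forall>y \<in> set xs. x < y" "\<forall>y \<in> set ys. x \<le> y"
  shows "left_to_right_minima (xs @ x # ys) = Suc (left_to_right_minima xs)"
  using assms(2)
proof (induction ys rule: rev_induct)
  case Nil
  then show ?case using assms(1) by (simp add: left_to_right_minima_snoc)
next
  case (snoc y ys)
  then show ?case using left_to_right_minima_snoc[of "xs @ x # ys" y] by fastforce
qed

lemma left_to_right_minima_map:
  assumes "strict_mono f"
  shows "left_to_right_minima (map f xs) = left_to_right_minima xs"
  using assms
  by (induction xs rule: rev_induct) (simp_all add: left_to_right_minima_snoc strict_mono_less)

text \<open>Each column of a Fibonacci polyomino starts one unit above the preceding one, hence the
  successor. The truncated subtraction is intended: only upward moves of the top count. Starting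
  from 1 makes the first entry contribute itself, so \<open>rise 1\<close> is the vertical semiperimeter;
  starting from 0 makes the value additive over the trees below.\<close>

fun rise :: "nat \<Rightarrow> nat list \<Rightarrow> nat" where
  "rise x [] = 0"
| "rise x (y # ys) = (Suc y - x) + rise y ys"

lemma rise_append: "rise x (xs @ ys) = rise x xs + rise (last (x # xs)) ys"
  by (induction xs arbitrary: x) auto

lemma rise_map_add: "rise (c + x) (map ((+) c) xs) = rise x xs"
  by (induction xs arbitrary: x) simp_all

lemma rise_start_add:
  assumes "xs \<noteq> []" "c + x \<le> Suc (hd xs)"
  shows "rise x xs = c + rise (c + x) xs"
  using assms by (cases xs) auto

lemma rise_map_add_start:
  assumes "xs \<noteq> []" "x \<le> Suc (hd xs)"
  shows "rise x (map ((+) c) xs) = c + rise x xs"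
  using rise_start_add[of "map ((+) c) xs" c x] assms by (simp add: hd_map rise_map_add)

lemma le_rise: "y \<in> set xs \<Longrightarrow> y \<le> x + rise x xs"
proof (induction xs arbitrary: x)
  case (Cons z zs)
  then consider "y = z" | "y \<le> z + rise z zs" by auto
  then show ?case by cases auto
qed simp

lemma finite_rise_eq: "finite {xs. length xs = m \<and> rise x xs = n}"
proof (rule finite_subset)
  show "{xs. length xs = m \<and> rise x xs = n} \<subseteq> {xs. set xs \<subseteq> {..x + n} \<and> length xs = m}"
    using le_rise by auto
qed (simp add: finite_lists_length_eq)

section \<open>Lists as labelled binary trees\<close>

lemma leftmost_minE:
  fixes zs :: "'a::linorder list"
  assumes "zs \<noteq> []"
  obtains xs x ys where "zs = xs @ x # ys" "\<forall>y \<in> set xs. x < y" "\<forall>y \<in> set ys. x \<le> y"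
proof -
  define x where "x = Min (set zs)"
  have lower_bound: "\<forall>y \<in> set zs. x \<le> y" by (simp add: x_def)
  have "x \<in> set zs" using assms by (simp add: x_def)
  then obtain xs ys where split: "zs = xs @ x # ys" "x \<notin> set xs"
    by (meson split_list_first)
  show thesis
  proof (rule that)
    show "\<forall>y \<in> set xs. x < y" using lower_bound split by (fastforce simp: order_less_le)
    show "\<forall>y \<in> set ys. x \<le> y" using lower_bound split(1) by simp
  qed (fact split(1))
qed

lemma leftmost_min_unique:
  fixes x x' :: "'a::linorder"
  assumes "xs @ x # ys = xs' @ x' # ys'"
    and "\<forall>y \<in> set xs. x < y" "\<forall>y \<in> set ys. x \<le> y"
    and "\<forall>y \<in> set xs'. x' < y" "\<forall>y \<in> set ys'. x' \<le> y"
  shows "xs = xs' \<and> x = x' \<and> ys = ys'"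
proof -
  have "set (xs @ x # ys) = set (xs' @ x' # ys')"
    using assms(1) by simp
  then have "x \<in> set (xs' @ x' # ys')" "x' \<in> set (xs @ x # ys)"
    by auto
  then have "x = x'"
    using assms(2-) by fastforce
  moreover have "x \<notin> set xs" "x' \<notin> set xs'"
    using assms(2,4) by auto
  ultimately have "takeWhile (\<lambda>y. y \<noteq> x) (xs @ x # ys) = xs"
    "takeWhile (\<lambda>y. y \<noteq> x) (xs' @ x' # ys') = xs'"
    by (auto simp: takeWhile_append takeWhile_eq_all_conv)
  then have "xs = xs'" using assms(1) by simp
  then show ?thesis using assms(1) by simp
qed

lemma map_add_map_diff:
  fixes c :: nat
  assumes "\<forall>y \<in> set xs. c \<le> y"
  shows "map ((+) c) (map (\<lambda>y. y - c) xs) = xs"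
  unfolding map_map using assms by (intro map_idI) auto

text \<open>Entries to the left of the leftmost minimum exceed it strictly, hence the shift by \<open>Suc p\<close>.\<close>

fun heights_of_tree :: "nat tree \<Rightarrow> nat list" where
  "heights_of_tree Leaf = []"
| "heights_of_tree (Node l p r) =
    map ((+) (Suc p)) (heights_of_tree l) @ p # map ((+) p) (heights_of_tree r)"

lemma length_heights_of_tree [simp]: "length (heights_of_tree t) = size t"
  by (induction t) auto

lemma heights_of_tree_eq_Nil [simp]: "heights_of_tree t = [] \<longleftrightarrow> t = Leaf"
  by (cases t) auto

lemma inj_heights_of_tree: "inj heights_of_tree"
proof (rule injI)
  fix s t assume "heights_of_tree s = heights_of_tree t"
  then show "s = t"
  proof (induction s arbitrary: t)
    case Leaf
    then show ?case by (metis heights_of_tree.simps(1) heights_of_tree_eq_Nil)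
  next
    case (Node l p r)
    then obtain l' p' r' where t_eq: "t = Node l' p' r'"
      by (cases t) auto
    have nodes_eq:
      "map ((+) (Suc p)) (heights_of_tree l) = map ((+) (Suc p')) (heights_of_tree l') \<and> p = p' \<and>
        map ((+) p) (heights_of_tree r) = map ((+) p') (heights_of_tree r')"
      by (rule leftmost_min_unique) (use Node.prems t_eq in auto)
    have "heights_of_tree l = heights_of_tree l'" "heights_of_tree r = heights_of_tree r'"
      using nodes_eq inj_map_eq_map[OF inj_on_add] by metis+
    then show ?case
      using nodes_eq Node.IH t_eq by blast
  qed
qed

lemma surj_heights_of_tree: "surj heights_of_tree"
proof -
  have "h \<in> range heights_of_tree" for h
  proof (induction "length h" arbitrary: h rule: less_induct)
    case less
    show ?case
    proof (cases "h = []")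
      case True
      then show ?thesis by (intro range_eqI[of _ _ Leaf]) simp
    next
      case False
      then obtain xs x ys
        where split: "h = xs @ x # ys" "\<forall>y \<in> set xs. x < y" "\<forall>y \<in> set ys. x \<le> y"
        by (rule leftmost_minE)
      have "map (\<lambda>y. y - Suc x) xs \<in> range heights_of_tree"
        "map (\<lambda>y. y - x) ys \<in> range heights_of_tree"
        using less split(1) by simp_all
      then obtain l r where "heights_of_tree l = map (\<lambda>y. y - Suc x) xs"
        and "heights_of_tree r = map (\<lambda>y. y - x) ys"
        by (metis rangeE)
      then have "heights_of_tree (Node l x r) = h"
        using split map_add_map_diff[of xs "Suc x"] map_add_map_diff[of ys x]
        by (simp add: Suc_le_eq del: map_map)
      then show ?thesis by blast
    qed
  qed
  then show ?thesis by blast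
qed

lemma rise_heights_of_tree: "rise 0 (heights_of_tree t) = sum_list (inorder t) + size t"
proof (induction t)
  case (Node l p r)
  let ?l = "map ((+) (Suc p)) (heights_of_tree l)"
  have right: "rise p (map ((+) p) (heights_of_tree r)) = rise 0 (heights_of_tree r)"
    using rise_map_add[of p 0] by simp
  have left: "rise 0 ?l + (Suc p - last (0 # ?l)) = rise 0 (heights_of_tree l) + Suc p"
  proof (cases "l = Leaf")
    case False
    then show ?thesis
      using rise_map_add_start[of "heights_of_tree l" 0 "Suc p"] by (simp add: last_map)
  qed simp
  show ?case
    using left right Node.IH by (simp add: rise_append del: last.simps)
qed simp

section \<open>Binary trees as Dyck paths\<close>

lemma level_0 [simp]: "level w 0 = 0"
  by (simp add: level_def)

lemma level_Nil [simp]: "level [] i = 0"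
  by (simp add: level_def)

lemma level_Cons_Suc [simp]:
  "level (s # w) (Suc i) = (case s of Up \<Rightarrow> 1 | Down \<Rightarrow> - 1) + level w i"
  by (simp add: level_def)

lemma level_append: "level (u @ v) i = level u i + level v (i - length u)"
  by (simp add: level_def)

lemma level_beyond: "length w < i \<Longrightarrow> level w i = level w (length w)"
  by (simp add: level_def)

lemma dyck_path_iff:
  "dyck_path k w \<longleftrightarrow> length w = 2 * k \<and> level w (2 * k) = 0 \<and> (\<forall>i. level w i \<ge> 0)"
  unfolding dyck_path_def by (metis level_beyond linorder_le_less_linear order_refl)

lemma dyck_path_append:
  "dyck_path k u \<Longrightarrow> dyck_path l v \<Longrightarrow> dyck_path (k + l) (u @ v)"
  by (cases "l = 0") (auto simp: dyck_path_iff level_append level_beyond)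

lemma dyck_path_elevate:
  assumes "dyck_path k w"
  shows "dyck_path (Suc k) (Up # w @ [Down])"
proof -
  have "level (Up # w @ [Down]) i \<ge> 0" for i
  proof (cases i)
    case (Suc i')
    have "1 + level w i' + level [Down] (i' - length w) \<ge> 0"
      using assms by (cases "i' - length w") (simp_all add: dyck_path_iff)
    then show ?thesis by (simp add: Suc level_append)
  qed simp
  then show ?thesis
    using assms by (simp add: dyck_path_iff level_append level_beyond)
qed

lemma returns_append:
  assumes "level u (length u) = 0"
  shows "returns (u @ v) = returns u + returns v"
proof -
  let ?P = "\<lambda>i. (u @ v) ! i = Down \<and> level (u @ v) (Suc i) = 0"
  have "{i. i < length u \<and> ?P i} = {i. i < length u \<and> u ! i = Down \<and> level u (Suc i) = 0}"
    by (auto simp: nth_append level_append)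
  moreover have "?P (length u + i) \<longleftrightarrow> v ! i = Down \<and> level v (Suc i) = 0" for i
    using assms by (simp add: level_append level_beyond)
  ultimately show ?thesis
    using card_less_add[of "length u" "length v" ?P] by (simp add: returns_def)
qed

lemma returns_elevate:
  assumes "dyck_path k w"
  shows "returns (Up # w @ [Down]) = 1"
proof -
  let ?w = "Up # w @ [Down]"
  have "?w ! i = Down \<and> level ?w (Suc i) = 0 \<longleftrightarrow> i = Suc (length w)" if "i < length ?w" for i
  proof (cases "i = Suc (length w)")
    case False
    then have "i \<le> length w" using that by simp
    then have "level ?w (Suc i) = 1 + level w i" by (simp add: level_append)
    then show ?thesis using assms False by (simp add: dyck_path_iff add_nonneg_eq_0_iff)
  qed (use assms in \<open>simp add: dyck_path_iff level_append level_beyond nth_append\<close>)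
  then have "{i. i < length ?w \<and> ?w ! i = Down \<and> level ?w (Suc i) = 0} = {Suc (length w)}"
    by auto
  then show ?thesis by (simp add: returns_def)
qed

fun dyck_word :: "'a tree \<Rightarrow> step list" where
  "dyck_word Leaf = []"
| "dyck_word (Node l p r) = dyck_word l @ Up # dyck_word r @ [Down]"

lemma dyck_word_eq_Nil [simp]: "dyck_word t = [] \<longleftrightarrow> t = Leaf"
  by (cases t) auto

lemma dyck_word_map_tree [simp]: "dyck_word (map_tree f t) = dyck_word t"
  by (induction t) auto

lemma dyck_path_dyck_word: "dyck_path (size t) (dyck_word t)"
proof (induction t)
  case Leaf
  then show ?case by (simp add: dyck_path_iff)
next
  case (Node l p r)
  then show ?case using dyck_path_append[OF _ dyck_path_elevate] by simp
qed

lemma last_dyck_word: "t \<noteq> Leaf \<Longrightarrow> last (dyck_word t) = Down"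
  by (cases t) auto

lemma hd_dyck_word: "t \<noteq> Leaf \<Longrightarrow> hd (dyck_word t) = Up"
proof (induction t)
  case (Node l p r)
  then show ?case by (cases "l = Leaf") auto
qed simp

lemma peaks_eq_count_consecutive: "peaks = count_consecutive (\<lambda>a b. a = Up \<and> b = Down)"
  by (simp add: fun_eq_iff peaks_def count_consecutive_def)

lemma peaks_Nil [simp]: "peaks [] = 0"
  by (simp add: peaks_def)

lemma peaks_dyck_word_Node:
  "peaks (dyck_word (Node l p r)) =
    peaks (dyck_word l) + (if r = Leaf then 1 else peaks (dyck_word r))"
  by (auto simp: peaks_eq_count_consecutive count_consecutive_append count_consecutive_Cons
      hd_append hd_dyck_word last_dyck_word)

lemma peaks_dyck_word_eq_0: "peaks (dyck_word t) = 0 \<longleftrightarrow> t = Leaf"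
proof (induction t)
  case Leaf
  then show ?case by simp
next
  case (Node l p r)
  then show ?case unfolding peaks_dyck_word_Node by auto
qed

lemma descents_heights_of_tree_Node:
  "descents (heights_of_tree (Node l p r)) =
    (if l = Leaf then 0 else Suc (descents (heights_of_tree l))) + descents (heights_of_tree r)"
  by (auto simp: count_consecutive_append count_consecutive_Cons count_consecutive_map
      hd_map last_map)

lemma peaks_dyck_word:
  "peaks (dyck_word t) = (if t = Leaf then 0 else Suc (descents (heights_of_tree t)))"
proof (induction t)
  case (Node l p r)
  then show ?case
    unfolding peaks_dyck_word_Node descents_heights_of_tree_Node by simp
qed simp

lemma returns_dyck_word: "returns (dyck_word t) = left_to_right_minima (heights_of_tree t)"
proof (induction t)
  case Leaf
  then show ?case by (simp add: returns_def)
next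
  case (Node l p r)
  have "left_to_right_minima (map ((+) (Suc p)) (heights_of_tree l)) =
      left_to_right_minima (heights_of_tree l)"
    by (rule left_to_right_minima_map) (simp add: strict_mono_def)
  then have "left_to_right_minima (heights_of_tree (Node l p r)) =
      Suc (left_to_right_minima (heights_of_tree l))"
    by (simp add: left_to_right_minima_append_Cons)
  moreover have "returns (dyck_word (Node l p r)) = Suc (returns (dyck_word l))"
    using dyck_path_dyck_word[of l] returns_elevate[OF dyck_path_dyck_word[of r]]
    by (simp add: returns_append dyck_path_iff)
  ultimately show ?case using Node.IH by simp
qed

text \<open>A shift-reduce parser recovers the tree from its word: an up step pushes an empty tree,
  a down step joins the two topmost trees.\<close>

fun parse_step :: "unit tree list \<Rightarrow> step \<Rightarrow> unit tree list" where
  "parse_step ts Up = Leaf # ts"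
| "parse_step (r # l # ts) Down = Node l () r # ts"
| "parse_step ts Down = ts"

fun unparse :: "unit tree list \<Rightarrow> step list" where
  "unparse [] = []"
| "unparse [t] = dyck_word t"
| "unparse (t # s # ts) = unparse (s # ts) @ Up # dyck_word t"

lemma foldl_parse_step_dyck_word:
  "foldl parse_step (Leaf # ts) (dyck_word t) = t # ts"
  by (induction t arbitrary: ts) auto

lemma inj_dyck_word: "inj (dyck_word :: unit tree \<Rightarrow> step list)"
  by (rule injI) (metis foldl_parse_step_dyck_word list.inject)

lemma unparse_foldl_parse_step:
  assumes "\<forall>i. level w i \<ge> 0"
  shows "int (length (foldl parse_step [Leaf] w)) = level w (length w) + 1 \<and>
    unparse (foldl parse_step [Leaf] w) = w"
  using assms
proof (induction w rule: rev_induct)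
  case (snoc s w)
  let ?ts = "foldl parse_step [Leaf] w"
  have "level w i \<ge> 0" for i
    using snoc.prems[rule_format, of "min i (length w)"] level_beyond[of w i]
    by (cases "i \<le> length w") (simp_all add: level_append)
  then have IH: "int (length ?ts) = level w (length w) + 1" "unparse ?ts = w" "?ts \<noteq> []"
    using snoc.IH by (auto simp: add_nonneg_eq_0_iff)
  have level_snoc: "level (w @ [s]) (length (w @ [s])) =
      level w (length w) + (case s of Up \<Rightarrow> 1 | Down \<Rightarrow> - 1)"
    by (simp add: level_append level_beyond)
  show ?case
  proof (cases s)
    case Up
    obtain t ts where "?ts = t # ts" using IH(3) by (cases ?ts) auto
    then show ?thesis using IH level_snoc Up by simp
  next
    case Down
    then have "length ?ts \<ge> 2"
      using IH(1) level_snoc snoc.prems[rule_format, of "length (w @ [s])"] by simp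
    then obtain r l ts where "?ts = r # l # ts"
      by (metis Suc_le_length_iff numeral_2_eq_2)
    then show ?thesis using IH level_snoc Down by (cases ts) auto
  qed
qed simp

lemma dyck_path_imp_dyck_word:
  assumes "dyck_path k w"
  obtains t :: "unit tree" where "dyck_word t = w" "size t = k"
proof -
  let ?ts = "foldl parse_step [Leaf] w"
  have "length ?ts = 1" and unparse_parse: "unparse ?ts = w"
    using unparse_foldl_parse_step[of w] assms by (auto simp: dyck_path_iff)
  then obtain t where "?ts = [t]"
    by (auto simp: length_Suc_conv)
  then have "dyck_word t = w" using unparse_parse by simp
  moreover from this have "size t = k"
    using assms dyck_path_dyck_word[of t] by (simp add: dyck_path_iff)
  ultimately show thesis by (rule that)
qed

lemma bij_betw_dyck_word:
  "bij_betw dyck_word {t :: unit tree. size t = k} {w. dyck_path k w}"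
proof (rule bij_betw_imageI)
  show "inj_on dyck_word {t :: unit tree. size t = k}"
    using inj_dyck_word by (rule inj_on_subset) simp
  show "dyck_word ` {t :: unit tree. size t = k} = {w. dyck_path k w}"
    using dyck_path_dyck_word by (blast elim: dyck_path_imp_dyck_word)
qed

lemma R_0_eq_0:
  assumes "k > 0"
  shows "R k 0 j = 0"
proof -
  have "peaks w \<noteq> 0" if dyck: "dyck_path k w" for w
  proof -
    obtain t :: "unit tree" where "dyck_word t = w" "size t = k"
      using dyck by (rule dyck_path_imp_dyck_word)
    moreover have "t \<noteq> Leaf" using \<open>size t = k\<close> assms by auto
    ultimately show ?thesis using peaks_dyck_word_eq_0 by blast
  qed
  then have "{w. dyck_path k w \<and> peaks w = 0 \<and> returns w = j} = {}" by blast
  then show ?thesis unfolding R_def by (simp only: card.empty)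
qed

section \<open>Counting lists by rise, descents and minima\<close>

abbreviation shape :: "'a tree \<Rightarrow> unit tree" where
  "shape \<equiv> map_tree (\<lambda>_. ())"

lemma tree_eqI_shape_inorder: "shape s = shape t \<Longrightarrow> inorder s = inorder t \<Longrightarrow> s = t"
proof (induction s arbitrary: t)
  case Leaf
  then show ?case by simp
next
  case (Node l p r)
  then obtain l' p' r' where t_eq: "t = Node l' p' r'"
    by (cases t) auto
  then have shapes: "shape l = shape l'" "shape r = shape r'"
    using Node.prems by auto
  then have "length (inorder l) = length (inorder l')"
    by (metis length_inorder size_map_tree)
  then show ?case using Node t_eq shapes by auto
qed

lemma ex_tree_shape_inorder:
  "length xs = size s \<Longrightarrow> \<exists>t. shape t = s \<and> inorder t = xs"
proof (induction s arbitrary: xs)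
  case Leaf
  then show ?case by (intro exI[of _ Leaf]) auto
next
  case (Node l u r)
  obtain l' where left: "shape l' = l" "inorder l' = take (size l) xs"
    using Node.IH(1)[of "take (size l) xs"] Node.prems by auto
  obtain r' where right: "shape r' = r" "inorder r' = drop (Suc (size l)) xs"
    using Node.IH(2)[of "drop (Suc (size l)) xs"] Node.prems by auto
  have "inorder (Node l' (xs ! size l) r') = xs"
    using Node.prems by (simp add: left right id_take_nth_drop[symmetric])
  then show ?case using left right by (intro exI[of _ "Node l' (xs ! size l) r'"]) simp
qed

lemma bij_betw_shape_inorder:
  "bij_betw (\<lambda>t. (shape t, inorder t)) {t. size t = m} ({s. size s = m} \<times> {xs. length xs = m})"
  (is "bij_betw ?f ?A ?B")
proof (rule bij_betw_imageI)
  show "inj_on ?f ?A"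
    by (auto intro: inj_onI tree_eqI_shape_inorder)
  have "(s, xs) \<in> ?f ` ?A" if "size s = m" "length xs = m" for s xs
  proof -
    obtain t where t_shape: "shape t = s" "inorder t = xs"
      using ex_tree_shape_inorder \<open>size s = m\<close> \<open>length xs = m\<close> by metis
    then have "t \<in> ?A" using \<open>length xs = m\<close> by auto
    then show ?thesis using t_shape by (auto intro!: image_eqI[of _ _ t])
  qed
  then show "?f ` ?A = ?B" by auto
qed

lemma bij_betw_dyck_word_inorder:
  "bij_betw (\<lambda>t. (dyck_word t, inorder t)) {t. size t = m}
    ({w. dyck_path m w} \<times> {xs. length xs = m})"
proof -
  have "bij_betw (map_prod dyck_word id) ({s :: unit tree. size s = m} \<times> {xs. length xs = m})
      ({w. dyck_path m w} \<times> {xs. length xs = m})"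
    by (intro bij_betw_map_prod bij_betw_dyck_word bij_betw_id)
  from bij_betw_trans[OF bij_betw_shape_inorder this] show ?thesis
    by (simp add: comp_def)
qed

lemma card_trees_dyck_word_inorder:
  "card {t. size t = m \<and> P (dyck_word t) \<and> Q (inorder t)} =
    card {w. dyck_path m w \<and> P w} * card {xs. length xs = m \<and> Q xs}"
proof -
  let ?A = "{w. dyck_path m w}" and ?B = "{xs. length xs = m}"
  have "bij_betw (\<lambda>t. (dyck_word t, inorder t))
      {t \<in> {t. size t = m}. P (dyck_word t) \<and> Q (inorder t)} {y \<in> ?A \<times> ?B. P (fst y) \<and> Q (snd y)}"
    by (intro bij_betw_Collect[OF bij_betw_dyck_word_inorder]) simp
  moreover have "{y \<in> ?A \<times> ?B. P (fst y) \<and> Q (snd y)} =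
      {w. dyck_path m w \<and> P w} \<times> {xs. length xs = m \<and> Q xs}"
    by auto
  ultimately show ?thesis
    using bij_betw_same_card by (fastforce simp: card_cartesian_product)
qed

lemma card_lists_sum_list_add_length:
  assumes "m > 0"
  shows "card {xs :: nat list. length xs = m \<and> sum_list xs + m = Suc N} = N choose (m - 1)"
proof (cases "m \<le> Suc N")
  case True
  then have "card {xs :: nat list. length xs = m \<and> sum_list xs + m = Suc N}
      = card {xs :: nat list. length xs = m \<and> sum_list xs = Suc N - m}"
    by (intro arg_cong[where f = card]) auto
  also have "\<dots> = N choose (N - (m - 1))"
    using assms True by (simp add: card_length_sum_list Suc_diff_le)
  also have "\<dots> = N choose (m - 1)"
    using True by (intro binomial_symmetric[symmetric]) simp
  finally show ?thesis .
next
  case False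
  then have "{xs :: nat list. length xs = m \<and> sum_list xs + m = Suc N} = {}" by auto
  then show ?thesis using False by (simp add: binomial_eq_0)
qed

definition height_lists :: "nat \<Rightarrow> nat \<Rightarrow> nat \<Rightarrow> nat \<Rightarrow> nat \<Rightarrow> nat list set" where
  "height_lists c m n d j = {h. (\<forall>x \<in> set h. c \<le> x) \<and> length h = m \<and> rise 1 h = n \<and>
     descents h = d \<and> left_to_right_minima h = j}"

lemma finite_height_lists: "finite (height_lists c m n d j)"
  by (rule finite_subset[OF _ finite_rise_eq[of m 1 n]]) (auto simp: height_lists_def)

lemma heights_of_tree_mem_height_lists_iff:
  assumes "m > 0"
  shows "heights_of_tree t \<in> height_lists 0 m n d j \<longleftrightarrow> size t = m \<and>
    (peaks (dyck_word t) = Suc d \<and> returns (dyck_word t) = j) \<and> sum_list (inorder t) + m = Suc n"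
proof (cases "t = Leaf")
  case True
  then show ?thesis using assms by (simp add: height_lists_def)
next
  case False
  then have "sum_list (inorder t) + size t = Suc (rise 1 (heights_of_tree t))"
    using rise_start_add[of "heights_of_tree t" 1 0] by (simp add: rise_heights_of_tree)
  then show ?thesis
    using False by (auto simp: height_lists_def peaks_dyck_word returns_dyck_word)
qed

lemma card_height_lists_0:
  assumes "m > 0"
  shows "card (height_lists 0 m n d j) = R m (Suc d) j * (n choose (m - 1))"
proof -
  have "card (height_lists 0 m n d j) = card (heights_of_tree -` height_lists 0 m n d j)"
    by (rule card_vimage_inj[symmetric]) (use inj_heights_of_tree surj_heights_of_tree in auto)
  also have "\<dots> = card {t. size t = m \<and> (peaks (dyck_word t) = Suc d \<and> returns (dyck_word t) = j) \<and>
      sum_list (inorder t) + m = Suc n}"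
    using assms by (simp add: vimage_def heights_of_tree_mem_height_lists_iff)
  also have "\<dots> = R m (Suc d) j * (n choose (m - 1))"
    using card_trees_dyck_word_inorder[of m "\<lambda>w. peaks w = Suc d \<and> returns w = j"
        "\<lambda>xs. sum_list xs + m = Suc n"]
    by (simp add: R_def card_lists_sum_list_add_length[OF assms])
  finally show ?thesis .
qed

lemma height_lists_eq_image:
  assumes "m > 0" "c \<le> n"
  shows "height_lists c m n d j = map ((+) c) ` height_lists 0 m (n - c) d j"
proof -
  have map_add_mem_iff:
    "map ((+) c) g \<in> height_lists c m n d j \<longleftrightarrow> g \<in> height_lists 0 m (n - c) d j" for g
  proof (cases "g = []")
    case False
    moreover have "strict_mono ((+) c)" by (simp add: strict_mono_def)
    ultimately show ?thesis
      using assms rise_map_add_start[of g 1 c]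
      by (auto simp: height_lists_def count_consecutive_map left_to_right_minima_map)
  qed (use assms in \<open>simp add: height_lists_def\<close>)
  show ?thesis
  proof
    show "height_lists c m n d j \<subseteq> map ((+) c) ` height_lists 0 m (n - c) d j"
    proof
      fix h assume in_height_lists: "h \<in> height_lists c m n d j"
      then have "h = map ((+) c) (map (\<lambda>x. x - c) h)"
        by (metis (no_types, lifting) height_lists_def map_add_map_diff mem_Collect_eq)
      then show "h \<in> map ((+) c) ` height_lists 0 m (n - c) d j"
        using in_height_lists map_add_mem_iff by (metis image_eqI)
    qed
  qed (use map_add_mem_iff in blast)
qed

lemma card_height_lists:
  assumes "m > 0" "c \<le> n"
  shows "card (height_lists c m n d j) = R m (Suc d) j * ((n - c) choose (m - 1))"
proof -
  have "inj_on (map ((+) c)) (height_lists 0 m (n - c) d j)"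
    by (auto intro: inj_onI simp: inj_map_eq_map)
  then show ?thesis
    by (simp only: height_lists_eq_image[OF assms] card_image card_height_lists_0[OF assms(1)])
qed

section \<open>Staircases of columns\<close>

definition staircase :: "int \<Rightarrow> int \<Rightarrow> nat list \<Rightarrow> cell set" where
  "staircase a b h =
    (\<Union>i<length h. {a + int i} \<times> {b + int i..<b + int i + int (h ! i)})"

lemma staircase_Nil [simp]: "staircase a b [] = {}"
  by (simp add: staircase_def)

lemma staircase_Cons:
  "staircase a b (k # h) = {a} \<times> {b..<b + int k} \<union> staircase (a + 1) (b + 1) h"
  by (simp add: staircase_def lessThan_Suc_eq_insert_0 image_image add.assoc)

lemma finite_staircase [simp]: "finite (staircase a b h)"
  by (simp add: staircase_def)

lemma staircase_fst_ge: "(x, y) \<in> staircase a b h \<Longrightarrow> a \<le> x"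
  by (auto simp: staircase_def)

lemma column_staircase:
  "i < length h \<Longrightarrow> column (staircase a b h) (a + int i) = {b + int i..<b + int i + int (h ! i)}"
  by (auto simp: column_def staircase_def)

lemma column_staircase_nonemptyE:
  assumes "column (staircase a b h) x \<noteq> {}"
  obtains i where "i < length h" "x = a + int i"
  using assms by (auto simp: column_def staircase_def)

lemma column_convex_staircase: "column_convex (staircase a b h)"
  unfolding column_convex_def
proof
  fix x
  have "\<exists>u v. column (staircase a b h) x = {u..<v}"
  proof (cases "column (staircase a b h) x = {}")
    case False
    then obtain i where "i < length h" "x = a + int i"
      by (rule column_staircase_nonemptyE)
    then show ?thesis by (auto simp: column_staircase)
  qed auto
  then show "\<exists>u v. column (staircase a b h) x = {u..v}"
    by (metis atLeastLessThanPlusOne_atLeastAtMost_int diff_add_cancel)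
qed

lemma mem_translate: "(x, y) \<in> translate t P \<longleftrightarrow> (x - fst t, y - snd t) \<in> P"
  unfolding translate_def by (force simp: image_iff)

lemma translate_staircase: "translate t (staircase a b h) = staircase (a + fst t) (b + snd t) h"
proof (intro set_eqI, clarify)
  fix x y
  show "(x, y) \<in> translate t (staircase a b h) \<longleftrightarrow> (x, y) \<in> staircase (a + fst t) (b + snd t) h"
    by (auto simp: mem_translate staircase_def algebra_simps)
qed

lemma staircase_translation_rel: "(staircase a b h, staircase a' b' h) \<in> translation_rel"
  using translate_staircase[of "(a' - a, b' - b)" a b h] by (auto simp: translation_rel_def)

lemma fst_image_staircase:
  assumes "\<forall>k \<in> set h. k > 0"
  shows "fst ` staircase a b h = (\<lambda>i. a + int i) ` {..<length h}"
  using assms by (auto simp: staircase_def image_UN fst_image_times)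

lemma column_heights_staircase:
  assumes "\<forall>k \<in> set h. k > 0"
  shows "column_heights (staircase a b h) = h"
proof -
  let ?xs = "map (\<lambda>i. a + int i) [0..<length h]"
  have "sorted ?xs" "distinct ?xs" "set ?xs = fst ` staircase a b h"
    using fst_image_staircase[OF assms]
    by (auto simp: sorted_iff_nth_mono distinct_map inj_on_def lessThan_atLeast0)
  then have "sorted_list_of_set (fst ` staircase a b h) = ?xs"
    using sorted_list_of_set.idem_if_sorted_distinct by metis
  then show ?thesis
    by (intro nth_equalityI) (auto simp: column_heights_def column_staircase)
qed

section \<open>Fibonacci polyominoes are staircases\<close>

definition adjacency :: "cell set \<Rightarrow> (cell \<times> cell) set" where
  "adjacency P = {(c, c'). c \<in> P \<and> c' \<in> P \<and> adjacent c c'}"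

lemma rtrancl_adjacency_mono: "P \<subseteq> Q \<Longrightarrow> (adjacency P)\<^sup>* \<subseteq> (adjacency Q)\<^sup>*"
  by (intro rtrancl_mono) (auto simp: adjacency_def)

lemma sym_rtrancl_adjacency: "sym ((adjacency P)\<^sup>*)"
  by (intro sym_rtrancl) (auto simp: sym_def adjacency_def adjacent_def)

lemma polyomino_iff:
  "polyomino P \<longleftrightarrow> finite P \<and> P \<noteq> {} \<and> (\<forall>c\<in>P. \<forall>c'\<in>P. (c, c') \<in> (adjacency P)\<^sup>*)"
  by (simp add: polyomino_def adjacency_def)

lemma polyominoI:
  assumes "finite P" "c \<in> P" "\<And>c'. c' \<in> P \<Longrightarrow> (c, c') \<in> (adjacency P)\<^sup>*"
  shows "polyomino P"
  unfolding polyomino_iff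
  using assms sym_rtrancl_adjacency by (meson empty_iff rtrancl_trans symD)

lemma column_connected:
  assumes "{a} \<times> {b..<b + int k} \<subseteq> P" "i < k"
  shows "((a, b), (a, b + int i)) \<in> (adjacency P)\<^sup>*"
  using assms(2)
proof (induction i)
  case (Suc i)
  have "((a, b + int i), (a, b + int (Suc i))) \<in> adjacency P"
    using Suc.prems assms(1) by (auto simp: adjacency_def adjacent_def)
  then show ?case using Suc by (meson Suc_lessD rtrancl.rtrancl_into_rtrancl)
qed simp

definition fibonacci_heights :: "nat list \<Rightarrow> bool" where
  "fibonacci_heights h \<longleftrightarrow> h \<noteq> [] \<and> last h \<ge> 1 \<and> (\<forall>k \<in> set (butlast h). k \<ge> 2)"

lemma fibonacci_heights_Nil [simp]: "\<not> fibonacci_heights []"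
  by (simp add: fibonacci_heights_def)

lemma fibonacci_heights_Cons:
  "fibonacci_heights (k # h) \<longleftrightarrow> (if h = [] then k \<ge> 1 else k \<ge> 2 \<and> fibonacci_heights h)"
  by (auto simp: fibonacci_heights_def)

lemma fibonacci_heights_snoc:
  "fibonacci_heights (h @ [k]) \<longleftrightarrow> (\<forall>x \<in> set h. x \<ge> 2) \<and> k \<ge> 1"
  by (auto simp: fibonacci_heights_def)

lemma fibonacci_heights_pos: "fibonacci_heights h \<Longrightarrow> \<forall>k \<in> set h. k > 0"
  by (cases h rule: rev_cases) (auto simp: fibonacci_heights_snoc)

lemma fibonacci_heightsI:
  assumes "h \<noteq> []" "\<And>i. i < length h \<Longrightarrow> h ! i \<ge> 1" "\<And>i. Suc i < length h \<Longrightarrow> h ! i \<ge> 2"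
  shows "fibonacci_heights h"
  using assms by (auto simp: fibonacci_heights_def last_conv_nth in_set_conv_nth nth_butlast)

lemma staircase_connected:
  "fibonacci_heights h \<Longrightarrow> c \<in> staircase a b h \<Longrightarrow> ((a, b), c) \<in> (adjacency (staircase a b h))\<^sup>*"
proof (induction h arbitrary: a b)
  case (Cons k h)
  let ?P = "staircase a b (k # h)"
  have column_subset: "{a} \<times> {b..<b + int k} \<subseteq> ?P"
    by (auto simp: staircase_Cons)
  from Cons.prems(2) consider (first_column) "c \<in> {a} \<times> {b..<b + int k}"
    | (later_column) "c \<in> staircase (a + 1) (b + 1) h"
    by (auto simp: staircase_Cons)
  then show ?case
  proof cases
    case first_column
    then have "c = (a, b + int (nat (snd c - b)))" "nat (snd c - b) < k"
      by (auto simp: prod_eq_iff)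
    then show ?thesis using column_connected[OF column_subset] by metis
  next
    case later_column
    then have first_ge_2: "k \<ge> 2" and tail: "fibonacci_heights h" "h \<noteq> []"
      using Cons.prems(1) by (auto simp: fibonacci_heights_Cons split: if_splits)
    have "((a, b), (a, b + 1)) \<in> (adjacency ?P)\<^sup>*"
      using column_connected[OF column_subset, of 1] first_ge_2 by simp
    moreover have "((a, b + 1), (a + 1, b + 1)) \<in> adjacency ?P"
      using first_ge_2 tail fibonacci_heights_pos[OF tail(1)]
      by (cases h) (auto simp: adjacency_def adjacent_def staircase_Cons)
    moreover have "((a + 1, b + 1), c) \<in> (adjacency ?P)\<^sup>*"
      using Cons.IH[OF tail(1) later_column]
        rtrancl_adjacency_mono[of "staircase (a + 1) (b + 1) h" ?P]
      by (auto simp: staircase_Cons)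
    ultimately show ?thesis by (meson rtrancl.rtrancl_into_rtrancl rtrancl_trans)
  qed
qed simp

lemma fibonacci_polyomino_staircase:
  assumes "fibonacci_heights h"
  shows "fibonacci_polyomino (staircase a b h)"
  unfolding fibonacci_polyomino_def
proof (intro conjI allI impI)
  let ?P = "staircase a b h"
  have pos: "h ! i > 0" if "i < length h" for i
    using fibonacci_heights_pos[OF assms] that by simp
  show "polyomino ?P"
  proof (rule polyominoI)
    show "(a, b) \<in> ?P"
      using assms fibonacci_heights_pos[OF assms] by (cases h) (auto simp: staircase_Cons)
  qed (use staircase_connected[OF assms] in auto)
  show "column_convex ?P" by (rule column_convex_staircase)
  fix x assume nonempty: "column ?P x \<noteq> {} \<and> column ?P (x + 1) \<noteq> {}"
  obtain i where x_eq: "i < length h" "x = a + int i"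
    using nonempty column_staircase_nonemptyE by blast
  obtain i' where "i' < length h" "x + 1 = a + int i'"
    using nonempty column_staircase_nonemptyE by blast
  then have next_eq: "Suc i < length h" "x + 1 = a + int (Suc i)"
    using x_eq by auto
  have "Min {u..<v} = u" if "u < v" for u v :: int
    using that by (intro Min_eqI) auto
  then show "Min (column ?P (x + 1)) = Min (column ?P x) + 1"
    unfolding next_eq(2) column_staircase[OF next_eq(1)]
    unfolding x_eq(2) column_staircase[OF x_eq(1)]
    using pos[OF x_eq(1)] pos[OF next_eq(1)] by simp
qed

lemma adjacency_crossing:
  assumes "(c, c') \<in> (adjacency P)\<^sup>*" "fst c \<le> x" "x < fst c'"
  shows "\<exists>y. (x, y) \<in> P \<and> (x + 1, y) \<in> P"
  using assms
proof (induction rule: rtrancl_induct)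
  case (step d e)
  show ?case
  proof (cases "x < fst d")
    case False
    have "d \<in> P" "e \<in> P" "adjacent d e"
      using step.hyps(2) by (auto simp: adjacency_def)
    moreover from this have "d = (x, snd d)" "e = (x + 1, snd d)"
      using False step.prems by (auto simp: adjacent_def prod_eq_iff abs_if split: if_splits)
    ultimately show ?thesis by metis
  qed (use step in blast)
qed simp

lemma polyomino_columns_overlap:
  assumes "polyomino P" "x \<in> fst ` P" "x' \<in> fst ` P" "x \<le> z" "z < x'"
  obtains y where "(z, y) \<in> P" "(z + 1, y) \<in> P"
proof -
  obtain c c' where "c \<in> P" "c' \<in> P" "x = fst c" "x' = fst c'"
    using assms(2,3) by auto
  then have "\<exists>y. (z, y) \<in> P \<and> (z + 1, y) \<in> P"
    using assms by (intro adjacency_crossing[of c c']) (auto simp: polyomino_iff)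
  then show thesis using that by blast
qed

lemma polyomino_fst_image:
  assumes "polyomino P"
  obtains a n where "n > 0" "fst ` P = (\<lambda>i. a + int i) ` {..<n}"
proof -
  define a where "a = Min (fst ` P)"
  define z where "z = Max (fst ` P)"
  have finite_fst: "finite (fst ` P)" and "fst ` P \<noteq> {}"
    using assms by (simp_all add: polyomino_iff)
  then have ends: "a \<in> fst ` P" "z \<in> fst ` P"
    unfolding a_def z_def by (rule Min_in, rule Max_in)
  have bounded: "fst ` P \<subseteq> {a..z}"
    using finite_fst by (intro subsetI) (simp add: a_def z_def)
  have "x \<in> fst ` P" if range: "a \<le> x" "x < z" for x
  proof -
    obtain y where "(x, y) \<in> P"
      using polyomino_columns_overlap[OF assms ends range] by blast
    then show ?thesis by (rule image_eqI[rotated]) simp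
  qed
  then have "fst ` P = {a..z}"
    using ends(2) bounded by (metis atLeastAtMost_iff order_le_less subsetI subset_antisym)
  also have "\<dots> = (\<lambda>i. a + int i) ` {..<nat (z - a + 1)}"
  proof (intro set_eqI iffI)
    fix x assume "x \<in> {a..z}"
    then show "x \<in> (\<lambda>i. a + int i) ` {..<nat (z - a + 1)}"
      by (intro image_eqI[of _ _ "nat (x - a)"]) auto
  qed auto
  finally have "fst ` P = (\<lambda>i. a + int i) ` {..<nat (z - a + 1)}" .
  moreover have "nat (z - a + 1) > 0" using ends bounded by auto
  ultimately show thesis using that by blast
qed

lemma mem_fst_image_iff: "x \<in> fst ` P \<longleftrightarrow> column P x \<noteq> {}"
  by (auto simp: column_def image_iff Bex_def)

lemma fibonacci_polyomino_column:
  assumes "fibonacci_polyomino P" "fst ` P = (\<lambda>i. a + int i) ` {..<n}" "i < n"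
  shows "column P (a + int i) = {Min (column P a) + int i..<
    Min (column P a) + int i + int (card (column P (a + int i)))}"
proof -
  have nonempty: "column P (a + int i) \<noteq> {}" if "i < n" for i
    using that assms(2) by (auto simp flip: mem_fst_image_iff)
  have Min_next: "Min (column P (x + 1)) = Min (column P x) + 1"
    if "column P x \<noteq> {}" "column P (x + 1) \<noteq> {}" for x
    using assms(1) that by (simp add: fibonacci_polyomino_def)
  have Min_column: "Min (column P (a + int i)) = Min (column P a) + int i"
    using assms(3)
  proof (induction i)
    case (Suc i)
    then show ?case
      using Min_next[of "a + int i"] nonempty[of i] nonempty[of "Suc i"] by (simp add: ac_simps)
  qed simp
  obtain u v where interval: "column P (a + int i) = {u..v}"
    using assms(1) unfolding fibonacci_polyomino_def column_convex_def by blast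
  then have "u \<le> v" using nonempty[OF assms(3)] by simp
  then have "Min {u..v} = u" by (intro Min_eqI) auto
  then have "u = Min (column P a) + int i" using Min_column interval by simp
  then show ?thesis
    using \<open>u \<le> v\<close> unfolding interval by auto
qed

lemma UN_columns: "(\<Union>x \<in> fst ` P. {x} \<times> column P x) = P"
  by (force simp: column_def)

lemma fibonacci_polyomino_imp_staircase:
  assumes "fibonacci_polyomino P"
  obtains a b where "P = staircase a b (column_heights P)" "fibonacci_heights (column_heights P)"
proof -
  have polyomino: "polyomino P" using assms by (simp add: fibonacci_polyomino_def)
  then obtain a n where n_pos: "n > 0" and fst_P: "fst ` P = (\<lambda>i. a + int i) ` {..<n}"
    by (rule polyomino_fst_image)
  define b where "b = Min (column P a)"
  define h where "h = map (\<lambda>i. card (column P (a + int i))) [0..<n]"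
  have length_h: "length h = n" by (simp add: h_def)
  have mem_fst: "a + int i \<in> fst ` P" if "i < n" for i
    using that fst_P by blast
  have column: "column P (a + int i) = {b + int i..<b + int i + int (h ! i)}" if "i < n" for i
    using fibonacci_polyomino_column[OF assms fst_P that] that by (simp add: b_def h_def)
  have P_eq: "P = staircase a b h"
    using UN_columns[of P] by (simp add: fst_P column staircase_def length_h)
  have heights: "fibonacci_heights h"
  proof (rule fibonacci_heightsI)
    show "h \<noteq> []" using n_pos length_h by auto
  next
    fix i assume "i < length h"
    then have "column P (a + int i) \<noteq> {}" using mem_fst length_h by (simp flip: mem_fst_image_iff)
    then show "1 \<le> h ! i" using column[of i] length_h \<open>i < length h\<close> by (cases "h ! i") auto
  next
    fix i assume in_range: "Suc i < length h"
    obtain y where "(a + int i, y) \<in> P" "(a + int i + 1, y) \<in> P"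
      using polyomino_columns_overlap[OF polyomino mem_fst[of i] mem_fst[of "Suc i"],
          of "a + int i"] in_range length_h by auto
    then have "y \<in> column P (a + int i)" "y \<in> column P (a + int (Suc i))"
      by (simp_all add: column_def ac_simps)
    then show "2 \<le> h ! i" using column[of i] column[of "Suc i"] in_range length_h by auto
  qed
  have "column_heights P = h"
    using column_heights_staircase fibonacci_heights_pos[OF heights] P_eq by simp
  then show thesis using that P_eq heights by simp
qed

lemma fibonacci_polyomino_translation_iff:
  assumes "fibonacci_polyomino P" "fibonacci_polyomino Q"
  shows "(P, Q) \<in> translation_rel \<longleftrightarrow> column_heights P = column_heights Q"
proof -
  obtain a b where P_eq: "P = staircase a b (column_heights P)"
      "fibonacci_heights (column_heights P)"
    using assms(1) by (rule fibonacci_polyomino_imp_staircase)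
  obtain a' b' where Q_eq: "Q = staircase a' b' (column_heights Q)"
    using assms(2) by (rule fibonacci_polyomino_imp_staircase)
  show ?thesis
  proof
    assume "(P, Q) \<in> translation_rel"
    then obtain t where "Q = translate t P"
      by (auto simp: translation_rel_def)
    then have "Q = staircase (a + fst t) (b + snd t) (column_heights P)"
      using P_eq(1) by (metis translate_staircase)
    then show "column_heights P = column_heights Q"
      using column_heights_staircase fibonacci_heights_pos[OF P_eq(2)] by metis
  next
    assume "column_heights P = column_heights Q"
    then show "(P, Q) \<in> translation_rel"
      using P_eq(1) Q_eq staircase_translation_rel by metis
  qed
qed

section \<open>Semiperimeters\<close>

lemma ex1_mem_pair_iff: "p \<noteq> q \<Longrightarrow> (\<exists>!c. c \<in> P \<and> (c = p \<or> c = q)) \<longleftrightarrow> (p \<in> P) \<noteq> (q \<in> P)"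
  by metis

definition horizontal_boundary :: "cell set \<Rightarrow> (int \<times> int) set" where
  "horizontal_boundary P = {e. \<exists>!c. c \<in> P \<and> e \<in> horizontal_edges c}"

definition vertical_boundary :: "cell set \<Rightarrow> (int \<times> int) set" where
  "vertical_boundary P = {e. \<exists>!c. c \<in> P \<and> e \<in> vertical_edges c}"

lemma mem_horizontal_boundary:
  "(x, y) \<in> horizontal_boundary P \<longleftrightarrow> ((x, y) \<in> P) \<noteq> ((x, y - 1) \<in> P)"
proof -
  have "(x, y) \<in> horizontal_edges c \<longleftrightarrow> c = (x, y) \<or> c = (x, y - 1)" for c
    by (cases c) (auto simp: horizontal_edges_def)
  then show ?thesis
    using ex1_mem_pair_iff[of "(x, y)" "(x, y - 1)" P] by (simp add: horizontal_boundary_def)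
qed

lemma mem_vertical_boundary:
  "(x, y) \<in> vertical_boundary P \<longleftrightarrow> ((x, y) \<in> P) \<noteq> ((x - 1, y) \<in> P)"
proof -
  have "(x, y) \<in> vertical_edges c \<longleftrightarrow> c = (x, y) \<or> c = (x - 1, y)" for c
    by (cases c) (auto simp: vertical_edges_def)
  then show ?thesis
    using ex1_mem_pair_iff[of "(x, y)" "(x - 1, y)" P] by (simp add: vertical_boundary_def)
qed

lemma horizontal_semiperimeter_column_convex:
  assumes "finite P" "column_convex P"
  shows "horizontal_semiperimeter P = real (card (fst ` P))"
proof -
  obtain u v where column: "column P x = {u x..v x}" for x
    using assms(2) unfolding column_convex_def by metis
  then have mem: "(x, y) \<in> P \<longleftrightarrow> u x \<le> y \<and> y \<le> v x" for x y
    by (auto simp: column_def set_eq_iff)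
  have "(x, y) \<in> horizontal_boundary P \<longleftrightarrow> x \<in> fst ` P \<and> (y = u x \<or> y = v x + 1)" for x y
  proof -
    have "x \<in> fst ` P \<longleftrightarrow> u x \<le> v x"
      by (simp add: mem_fst_image_iff column)
    then show ?thesis
      by (auto simp: mem_horizontal_boundary mem)
  qed
  then have "horizontal_boundary P = (SIGMA x:fst ` P. {u x, v x + 1})"
    by auto
  moreover have "card {u x, v x + 1} = 2" if "x \<in> fst ` P" for x
    using that by (simp add: mem_fst_image_iff column)
  ultimately have "card (horizontal_boundary P) = 2 * card (fst ` P)"
    using assms(1) by simp
  then show ?thesis
    by (simp add: horizontal_semiperimeter_def flip: horizontal_boundary_def)
qed

lemma finite_vertical_boundary:
  assumes "finite P"
  shows "finite (vertical_boundary P)"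
proof (rule finite_subset)
  show "vertical_boundary P \<subseteq> P \<union> (\<lambda>(x, y). (x + 1, y)) ` P"
    by (force simp: mem_vertical_boundary image_iff)
qed (use assms in simp)

lemma finite_column:
  assumes "finite P"
  shows "finite (column P x)"
proof (rule finite_subset)
  show "column P x \<subseteq> snd ` P" by (force simp: column_def)
qed (use assms in simp)

lemma card_vertical_boundary_add_column:
  assumes "finite A" "finite S" and right: "\<And>x y. (x, y) \<in> S \<Longrightarrow> a < x"
  shows "card (vertical_boundary ({a} \<times> A \<union> S)) + card (column S (a + 1)) =
    card A + card (sym_diff A (column S (a + 1))) + card (vertical_boundary S)"
proof -
  let ?C = "column S (a + 1)"
  define beyond where "beyond = {(x, y) \<in> vertical_boundary S. a + 1 < x}"
  have "beyond \<subseteq> vertical_boundary S" by (auto simp: beyond_def)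
  then have finite: "finite beyond" "finite ?C"
    using assms(2) finite_vertical_boundary finite_column finite_subset by blast+
  have "(x, y) \<in> vertical_boundary S \<longleftrightarrow> (x, y) \<in> {a + 1} \<times> ?C \<union> beyond" for x y
    by (cases "x = a + 1") (auto simp: beyond_def mem_vertical_boundary column_def dest: right)
  then have "vertical_boundary S = {a + 1} \<times> ?C \<union> beyond"
    by (auto simp del: Un_iff)
  moreover have "card ({a + 1} \<times> ?C \<union> beyond) = card ?C + card beyond"
    using finite by (subst card_Un_disjoint) (auto simp: beyond_def card_cartesian_product)
  ultimately have "card (vertical_boundary S) = card ?C + card beyond"
    by simp
  moreover have "(x, y) \<in> vertical_boundary ({a} \<times> A \<union> S) \<longleftrightarrow>
      (x, y) \<in> {a} \<times> A \<union> ({a + 1} \<times> sym_diff A ?C \<union> beyond)" for x y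
  proof -
    consider "x < a" | "x = a" | "x = a + 1" | "x > a + 1" by linarith
    then show ?thesis
      by cases (auto simp: beyond_def mem_vertical_boundary column_def dest: right)
  qed
  then have "vertical_boundary ({a} \<times> A \<union> S) =
      {a} \<times> A \<union> ({a + 1} \<times> sym_diff A ?C \<union> beyond)"
    by (auto simp del: Un_iff)
  moreover have "card ({a + 1} \<times> sym_diff A ?C \<union> beyond) = card (sym_diff A ?C) + card beyond"
    using finite assms(1)
    by (subst card_Un_disjoint) (auto simp: beyond_def card_cartesian_product)
  moreover have "card ({a} \<times> A \<union> ({a + 1} \<times> sym_diff A ?C \<union> beyond)) =
      card A + card ({a + 1} \<times> sym_diff A ?C \<union> beyond)"
    using finite assms(1)
    by (subst card_Un_disjoint) (auto simp: beyond_def card_cartesian_product)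
  ultimately show ?thesis by simp
qed

lemma card_sym_diff_columns:
  fixes b :: int
  assumes "k > 0"
  shows "card (sym_diff {b..<b + int k} {b + 1..<b + 1 + int l}) + l = k + 2 * (Suc l - k)"
proof -
  have "sym_diff {b..<b + int k} {b + 1..<b + 1 + int l}
      = insert b {min (b + int k) (b + 1 + int l)..<max (b + int k) (b + 1 + int l)}"
    using assms by auto
  then show ?thesis using assms by (auto simp: card_insert_if)
qed

lemma card_vertical_boundary_staircase:
  "\<forall>k \<in> set h. k > 0 \<Longrightarrow> card (vertical_boundary (staircase a b h)) = 2 * rise 1 h"
proof (induction h arbitrary: a b)
  case Nil
  have "vertical_boundary {} = {}" by (auto simp: mem_vertical_boundary)
  then show ?case by simp
next
  case (Cons k h)
  let ?S = "staircase (a + 1) (b + 1) h" and ?A = "{b..<b + int k}"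
  have boundary_Cons: "card (vertical_boundary (staircase a b (k # h))) + card (column ?S (a + 1)) =
      k + card (sym_diff ?A (column ?S (a + 1))) + 2 * rise 1 h"
    using card_vertical_boundary_add_column[of ?A ?S a] staircase_fst_ge[of _ _ "a + 1"] Cons
    by (fastforce simp: staircase_Cons)
  show ?case
  proof (cases h)
    case Nil
    then show ?thesis using boundary_Cons by (simp add: column_def)
  next
    case (Cons l h')
    then have "column ?S (a + 1) = {b + 1..<b + 1 + int l}"
      using column_staircase[of 0 h "a + 1" "b + 1"] by simp
    then show ?thesis
      using boundary_Cons card_sym_diff_columns[of k b l] Cons.prems Cons by simp
  qed
qed

lemma horizontal_semiperimeter_fibonacci_polyomino:
  assumes "fibonacci_polyomino P"
  shows "horizontal_semiperimeter P = real (length (column_heights P))"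
  using assms
  by (simp add: fibonacci_polyomino_def polyomino_iff horizontal_semiperimeter_column_convex
      column_heights_def)

lemma vertical_semiperimeter_fibonacci_polyomino:
  assumes "fibonacci_polyomino P"
  shows "vertical_semiperimeter P = real (rise 1 (column_heights P))"
proof -
  obtain a b where "P = staircase a b (column_heights P)" "fibonacci_heights (column_heights P)"
    using assms by (rule fibonacci_polyomino_imp_staircase)
  then have "card (vertical_boundary P) = 2 * rise 1 (column_heights P)"
    using card_vertical_boundary_staircase fibonacci_heights_pos by metis
  then show ?thesis
    by (simp add: vertical_semiperimeter_def flip: vertical_boundary_def)
qed

section \<open>Counting Fibonacci polyominoes\<close>

lemma card_quotient_eq_card_image:
  assumes "equiv UNIV r" and rel_iff: "\<And>x y. x \<in> A \<Longrightarrow> y \<in> A \<Longrightarrow> (x, y) \<in> r \<longleftrightarrow> f x = f y"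
  shows "card (A // r) = card (f ` A)"
proof -
  let ?g = "\<lambda>z. r `` {inv_into A f z}"
  have class_eq: "?g (f x) = r `` {x}" if "x \<in> A" for x
  proof (rule equiv_class_eq[OF assms(1)])
    show "(inv_into A f (f x), x) \<in> r"
      using that rel_iff by (simp add: inv_into_into f_inv_into_f)
  qed
  have "inj_on ?g (f ` A)"
  proof (rule inj_onI, clarify)
    fix x y assume "x \<in> A" "y \<in> A" "?g (f x) = ?g (f y)"
    then have "(x, y) \<in> r" using class_eq eq_equiv_class_iff[OF assms(1)] by simp
    then show "f x = f y" using rel_iff \<open>x \<in> A\<close> \<open>y \<in> A\<close> by blast
  qed
  moreover have "?g ` f ` A = A // r"
    using class_eq by (auto simp: quotient_def image_image)
  ultimately show ?thesis by (metis card_image)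
qed

definition fibonacci_height_lists :: "nat \<Rightarrow> nat \<Rightarrow> nat \<Rightarrow> nat \<Rightarrow> nat list set" where
  "fibonacci_height_lists m n d j = {h. fibonacci_heights h \<and> length h = m \<and> rise 1 h = n \<and>
     descents h = d \<and> left_to_right_minima h = j}"

lemma column_heights_image:
  "column_heights ` {P \<in> fibonacci_polyominoes m n. des P = d \<and> lmin P = j} =
    fibonacci_height_lists m n d j" (is "column_heights ` ?X = ?H")
proof -
  have mem_iff: "P \<in> ?X \<longleftrightarrow> column_heights P \<in> ?H" if fib: "fibonacci_polyomino P" for P
  proof -
    have "fibonacci_heights (column_heights P)"
      using fib by (rule fibonacci_polyomino_imp_staircase)
    then show ?thesis
      using fib by (simp add: fibonacci_polyominoes_def fibonacci_height_lists_def des_def lmin_def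
          horizontal_semiperimeter_fibonacci_polyomino vertical_semiperimeter_fibonacci_polyomino
          count_consecutive_def left_to_right_minima_def Let_def)
  qed
  show ?thesis
  proof
    show "column_heights ` ?X \<subseteq> ?H"
      using mem_iff by (auto simp: fibonacci_polyominoes_def)
    show "?H \<subseteq> column_heights ` ?X"
    proof
      fix h assume h_mem: "h \<in> ?H"
      let ?P = "staircase 0 0 h"
      have "fibonacci_heights h" using h_mem by (simp add: fibonacci_height_lists_def)
      then have "fibonacci_polyomino ?P" and heights: "column_heights ?P = h"
        by (simp_all add: fibonacci_polyomino_staircase column_heights_staircase
            fibonacci_heights_pos)
      then have "?P \<in> ?X" using h_mem mem_iff[of ?P] by simp
      then show "h \<in> column_heights ` ?X"
        using heights by (intro image_eqI[of h _ ?P]) simp_all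
    qed
  qed
qed

lemma card_fibonacci_polyominoes:
  "card ({P \<in> fibonacci_polyominoes m n. des P = d \<and> lmin P = j} // translation_rel) =
    card (fibonacci_height_lists m n d j)"
  unfolding column_heights_image[symmetric]
  by (rule card_quotient_eq_card_image[OF equiv_translation_rel])
    (simp add: fibonacci_polyominoes_def fibonacci_polyomino_translation_iff)

lemma snoc_1_mem_fibonacci_height_lists_iff:
  assumes "m > 0"
  shows "g @ [1] \<in> fibonacci_height_lists (Suc m) n d (Suc j) \<longleftrightarrow>
    (\<exists>d'. d = Suc d' \<and> g \<in> height_lists 2 m n d' j)"
proof (cases "g \<noteq> [] \<and> (\<forall>x \<in> set g. x \<ge> 2)")
  case True
  then have "Suc (Suc 0) \<le> last g" "\<forall>x \<in> set g. Suc 0 < x"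
    by (fastforce simp: numeral_2_eq_2)+
  then show ?thesis
    using True by (auto simp: fibonacci_height_lists_def height_lists_def fibonacci_heights_snoc
        rise_append count_consecutive_append count_consecutive_Cons left_to_right_minima_snoc)
next
  case False
  then show ?thesis
    using assms by (auto simp: fibonacci_height_lists_def height_lists_def fibonacci_heights_snoc)
qed

lemma fibonacci_height_lists_split:
  assumes "m > 0"
  shows "fibonacci_height_lists m n d j =
    height_lists 2 m n d j \<union> (\<lambda>g. g @ [1]) ` {g. g @ [1] \<in> fibonacci_height_lists m n d j}"
proof (rule set_eqI)
  fix h
  show "h \<in> fibonacci_height_lists m n d j \<longleftrightarrow> h \<in> height_lists 2 m n d j \<union>
      (\<lambda>g. g @ [1]) ` {g. g @ [1] \<in> fibonacci_height_lists m n d j}"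
  proof (cases h rule: rev_cases)
    case Nil
    then show ?thesis using assms by (auto simp: fibonacci_height_lists_def height_lists_def)
  next
    case (snoc g k)
    then show ?thesis
      by (cases "k = 1")
        (auto simp: fibonacci_height_lists_def height_lists_def fibonacci_heights_snoc)
  qed
qed

lemma card_fibonacci_height_lists:
  assumes "m > 0" "n \<ge> 2"
  shows "card (fibonacci_height_lists (Suc m) n d (Suc j)) =
    R (Suc m) (Suc d) (Suc j) * ((n - 2) choose m) + R m d j * ((n - 2) choose (m - 1))"
proof -
  let ?A = "height_lists 2 (Suc m) n d (Suc j)"
  let ?B = "{g. g @ [1] \<in> fibonacci_height_lists (Suc m) n d (Suc j)}"
  have B_eq: "?B = {g. \<exists>d'. d = Suc d' \<and> g \<in> height_lists 2 m n d' j}"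
    using snoc_1_mem_fibonacci_height_lists_iff[OF assms(1)] by blast
  have card_B: "finite ?B \<and> card ?B = R m d j * ((n - 2) choose (m - 1))"
  proof (cases d)
    case 0
    then have "?B = {}" using B_eq by simp
    then show ?thesis using 0 assms by (simp add: R_0_eq_0)
  next
    case (Suc d')
    then have "?B = height_lists 2 m n d' j" using B_eq by simp
    then show ?thesis using Suc assms by (simp add: finite_height_lists card_height_lists)
  qed
  have "?A \<inter> (\<lambda>g. g @ [1]) ` ?B = {}"
    by (auto simp: height_lists_def)
  then have "card (?A \<union> (\<lambda>g. g @ [1]) ` ?B) = card ?A + card ?B"
    using card_B by (simp add: card_Un_disjoint card_image finite_height_lists inj_on_def)
  then show ?thesis
    using fibonacci_height_lists_split[of "Suc m" n d "Suc j"] card_B assms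
    by (simp add: card_height_lists)
qed

theorem theorem4p1:
  fixes m n d j :: nat
  assumes "m \<ge> 2" and "n \<ge> 2" and "j \<ge> 1"
  shows "card ({P \<in> fibonacci_polyominoes m n. des P = d \<and> lmin P = j} // translation_rel)
    = R m (d + 1) j * ((n - 2) choose (m - 1))
      + R (m - 1) d (j - 1) * ((n - 2) choose (m - 2))"
proof -
  have "card ({P \<in> fibonacci_polyominoes m n. des P = d \<and> lmin P = j} // translation_rel)
      = card (fibonacci_height_lists m n d j)"
    by (rule card_fibonacci_polyominoes)
  also have "\<dots> = R m (d + 1) j * ((n - 2) choose (m - 1))
      + R (m - 1) d (j - 1) * ((n - 2) choose (m - 2))"
    using card_fibonacci_height_lists[of "m - 1" n d "j - 1"] assms by (simp add: numeral_2_eq_2)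
  finally show ?thesis .
qed

end
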